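(* Suppose that $r\in\mathbb N$ and $g\in\mathcal E$ satisfy $T^rg=g$. Then $g=h$.
   Context: "Decreasing" means non-increasing; $\int f:=\int_0^1 f(x)\,dx$. Let $\mathcal M$ be the set of measurable $f\colon[0,1]\to[0,\infty)$ with $\int f>0$, and $\mathcal E$ the set of decreasing $f\in\mathcal M$ with $f(0)=1$. For $g\in\mathcal E$ its pseudo-inverse is $g^*(y):=\sup\{x\in[0,1]: g(x)\ge y\}$ for $y\in[0,1]$; then $g^*\in\mathcal E$ and $\int g^*=\int g$. Define the operator $T$ on $\mathcal E$ by $(Tf)(x)=\frac{\int_x^1 f^*}{\int f}$ for $x\in[0,1]$, with iterates $T^n=T\circ T^{n-1}$, $T^0=\mathrm{id}$. Let $h_0\equiv1$ on $[0,1]$ and $h_n:=T^nh_0$. The sequence $(h_n)$ converges uniformly on $[0,1]$; let $h$ denote its limit (it satisfies $Th=h$). *)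

theory Defs
  imports "HOL-Analysis.Analysis"
begin

text \<open>Functions on [0,1] are modelled as real \<Rightarrow> real; only their values on [0,1] matter.\<close>

definition in_E :: "(real \<Rightarrow> real) \<Rightarrow> bool" where
  "in_E f \<longleftrightarrow>
     f \<in> borel_measurable (lebesgue_on {0..1}) \<and>
     (\<forall>x\<in>{0..1}. 0 \<le> f x) \<and>
     integral {0..1} f > 0 \<and>
     (\<forall>x\<in>{0..1}. \<forall>y\<in>{0..1}. x \<le> y \<longrightarrow> f y \<le> f x) \<and>
     f 0 = 1"

definition pinv :: "(real \<Rightarrow> real) \<Rightarrow> real \<Rightarrow> real" where
  "pinv g y = Sup {x \<in> {0..1}. g x \<ge> y}"

definition Top :: "(real \<Rightarrow> real) \<Rightarrow> real \<Rightarrow> real" where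
  "Top f x = integral {x..1} (pinv f) / integral {0..1} f"

definition hseq :: "nat \<Rightarrow> real \<Rightarrow> real" where
  "hseq n = (Top ^^ n) (\<lambda>_. 1)"

definition hlim :: "real \<Rightarrow> real" where
  "hlim x = lim (\<lambda>n. hseq n x)"

end

theory Submission
  imports Defs
begin

text \<open>
  Call \<open>f\<close> below \<open>g\<close> if \<open>g(x) - b f(x/a)\<close> never takes the signs minus, plus, minus in this
  order, for all \<open>a, b > 0\<close>. Inversion swaps the roles of \<open>a\<close> and \<open>b\<close>, and integrating tails
  cannot create sign changes, so \<open>Top\<close> preserves this relation. The constant function \<open>h\<^sub>0\<close> is
  below everything, hence \<open>h\<^sub>n\<close> is below \<open>h\<^sub>n\<^sub>+\<^sub>1\<close> and below all iterates \<open>g\<^sub>i\<close> of a periodic point.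
  This gives \<open>g\<^sub>i \<le> h\<^sub>n\<close> pointwise (so \<open>h\<^sub>n\<close> decreases to a limit), and, by comparing slopes at the
  origin, \<open>h\<^sub>n\<^sub>+\<^sub>1(x) \<le> g\<^sub>i\<^sub>+\<^sub>1(\<rho> x)\<close> with \<open>\<rho> = \<integral>g\<^sub>i / \<integral>h\<^sub>n\<close>. Integrating and letting \<open>n\<close> grow,
  \<open>\<integral>g\<^sub>i \<le> \<integral>g\<^sub>i\<^sub>+\<^sub>1\<close>; by periodicity these integrals agree, and the equality case forces the
  limiting \<open>\<rho>\<close> to be 1, that is, \<open>h \<le> g\<^sub>i\<close>.
\<close>

section \<open>Monotonicity and integrability in the class \<open>in_E\<close>\<close>

lemma in_E_antimono: "in_E f \<Longrightarrow> 0 \<le> x \<Longrightarrow> x \<le> y \<Longrightarrow> y \<le> 1 \<Longrightarrow> f y \<le> f x"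
  unfolding in_E_def by auto

lemma in_E_bounds:
  assumes "in_E f" "0 \<le> x" "x \<le> 1"
  shows "0 \<le> f x" "f x \<le> 1"
  using assms in_E_antimono[of f 0 x] unfolding in_E_def by auto

lemma integrable_on_antimono_on:
  fixes f :: "real \<Rightarrow> real"
  assumes "antimono_on {a..b} f"
  shows "f integrable_on {a..b}"
proof -
  have "mono_on {a..b} (\<lambda>x. - f x)"
    using assms by (auto simp: monotone_on_def)
  then have "(\<lambda>x. - f x) integrable_on {a..b}"
    by (rule integrable_on_mono_on)
  then show ?thesis
    by (simp add: integrable_neg_iff)
qed

lemma in_E_integrable:
  assumes "in_E f" "0 \<le> a" "b \<le> 1"
  shows "f integrable_on {a..b}"
  by (rule integrable_on_antimono_on)
    (use assms in_E_antimono[OF assms(1)] in \<open>auto simp: monotone_on_def\<close>)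

section \<open>The pseudo-inverse and its integral\<close>

lemma pinv_ge: "0 \<le> x \<Longrightarrow> x \<le> 1 \<Longrightarrow> y \<le> f x \<Longrightarrow> x \<le> pinv f y"
  unfolding pinv_def by (rule cSup_upper) (auto intro: bdd_aboveI[of _ 1])

lemma pinv_le:
  assumes "in_E f" "0 \<le> x" "x \<le> 1" "y \<le> 1" "f x < y"
  shows "pinv f y \<le> x"
  unfolding pinv_def
proof (rule cSup_least)
  show "{x \<in> {0..1}. y \<le> f x} \<noteq> {}"
    using assms by (auto simp: in_E_def intro!: exI[of _ 0])
  show "t \<le> x" if "t \<in> {x \<in> {0..1}. y \<le> f x}" for t
    using that assms in_E_antimono[OF assms(1), of x t] by (cases "t \<le> x") auto
qed

lemma pinv_bounds:
  assumes "in_E f" "y \<le> 1"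
  shows "0 \<le> pinv f y" "pinv f y \<le> 1"
proof -
  show "0 \<le> pinv f y"
    using assms by (intro pinv_ge) (auto simp: in_E_def)
  show "pinv f y \<le> 1"
    unfolding pinv_def
    by (rule cSup_least) (use assms in \<open>auto simp: in_E_def intro!: exI[of _ 0]\<close>)
qed

lemma pinv_antimono:
  assumes "in_E f" "y \<le> z" "z \<le> 1"
  shows "pinv f z \<le> pinv f y"
  unfolding pinv_def
  by (rule cSup_subset_mono)
    (use assms in \<open>auto simp: in_E_def intro!: bdd_aboveI[of _ 1] exI[of _ 0]\<close>)

text \<open>Beyond 1, \<open>pinv f\<close> is the supremum of the empty set, an unspecified value.\<close>

definition pinv0 :: "(real \<Rightarrow> real) \<Rightarrow> real \<Rightarrow> real" where
  "pinv0 f y = (if y \<le> 1 then pinv f y else 0)"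

lemma pinv0_antimono:
  assumes "in_E f"
  shows "antimono_on A (pinv0 f)"
  using pinv_antimono[OF assms] pinv_bounds[OF assms]
  by (auto simp: monotone_on_def pinv0_def)

lemma pinv0_nonneg: "in_E f \<Longrightarrow> 0 \<le> pinv0 f y"
  using pinv_bounds[of f y] by (auto simp: pinv0_def)

lemma pinv0_le_1: "in_E f \<Longrightarrow> pinv0 f y \<le> 1"
  using pinv_bounds[of f y] by (auto simp: pinv0_def)

lemma pinv0_integrable: "in_E f \<Longrightarrow> pinv0 f integrable_on {a..b}"
  by (intro integrable_on_antimono_on pinv0_antimono)

lemma Top_pinv0: "Top f x = integral {x..1} (pinv0 f) / integral {0..1} f"
  unfolding Top_def by (auto simp: pinv0_def intro!: arg_cong2[where f="(/)"] integral_cong)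

text \<open>Both integrals are the area under the graph of \<open>f\<close>, sliced vertically and
  horizontally (Tonelli).\<close>

lemma integral_pinv0:
  assumes E: "in_E f"
  shows "integral {0..1} (pinv0 f) = integral {0..1} f"
proof -
  \<comment> \<open>Clamping the argument makes \<open>F\<close> antitone on the whole line, hence
    Borel measurable.\<close>
  define F where "F x = f (max 0 (min 1 x))" for x
  have "mono (\<lambda>x. - F x)"
    unfolding F_def by (intro monoI) (auto intro!: in_E_antimono[OF E])
  then have "(\<lambda>x. - (- F x)) \<in> borel_measurable borel"
    by (intro borel_measurable_uminus borel_measurable_mono)
  then have [measurable]: "F \<in> borel_measurable borel"
    by simp
  have F_eq: "F x = f x" if "x \<in> {0..1}" for x
    using that by (auto simp: F_def min_def max_def)
  define A where "A = {z :: real \<times> real. 0 \<le> fst z \<and> fst z \<le> 1 \<and> 0 \<le> snd z \<and> snd z \<le> F (fst z)}"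
  have "{z \<in> space (borel \<Otimes>\<^sub>M borel). 0 \<le> fst z \<and> fst z \<le> 1 \<and> 0 \<le> snd z \<and> snd z \<le> F (fst z)}
      \<in> sets (borel \<Otimes>\<^sub>M borel)"
    by measurable
  then have A: "A \<in> sets (lborel \<Otimes>\<^sub>M lborel)"
    unfolding A_def by (simp add: space_pair_measure)
  have x_sections: "emeasure lborel (Pair x -` A) = ennreal (indicator {0..1} x * f x)" for x
  proof -
    have "Pair x -` A = (if x \<in> {0..1} then {0..f x} else {})"
      using F_eq by (auto simp: A_def)
    then show ?thesis
      using in_E_bounds[OF E, of x] by auto
  qed
  have y_sections: "emeasure lborel ((\<lambda>x. (x, y)) -` A) = ennreal (indicator {0..1} y * pinv0 f y)" for y
  proof (cases "y \<in> {0..1}")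
    case True
    let ?S = "(\<lambda>x. (x, y)) -` A" and ?p = "pinv f y"
    have p: "0 \<le> ?p" "?p \<le> 1"
      using pinv_bounds[OF E] True by auto
    \<comment> \<open>Whether the endpoint \<open>?p\<close> itself belongs to the section depends
      on \<open>f\<close>, but it carries no measure.\<close>
    have lower: "{0..<?p} \<subseteq> ?S"
    proof
      fix x assume x: "x \<in> {0..<?p}"
      then have "\<not> f x < y"
        using pinv_le[OF E, of x y] p True by auto
      then show "x \<in> ?S"
        using x True p F_eq[of x] by (auto simp: A_def)
    qed
    have upper: "?S \<subseteq> {0..?p}"
      using pinv_ge[of _ y f] F_eq by (auto simp: A_def)
    have meas: "?S \<in> sets lborel"
      using measurable_sets[OF measurable_Pair2'[of y lborel lborel] A] by simp
    have "emeasure lborel {0..<?p} \<le> emeasure lborel ?S"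
      by (rule emeasure_mono[OF lower meas])
    moreover have "emeasure lborel ?S \<le> emeasure lborel {0..?p}"
      by (rule emeasure_mono[OF upper]) simp
    ultimately show ?thesis
      using p True by (simp add: pinv0_def)
  next
    case False
    have "(\<lambda>x. (x, y)) -` A = {}"
    proof -
      have "F x \<le> 1" for x
        unfolding F_def by (rule in_E_bounds(2)[OF E]) auto
      then show ?thesis
        using False by (fastforce simp: A_def intro: order_trans)
    qed
    then show ?thesis
      using False by simp
  qed
  have "ennreal (integral {0..1} f) = (\<integral>\<^sup>+x. ennreal (indicator {0..1} x * f x) \<partial>lborel)"
    by (rule nn_integral_has_integral_lebesgue[symmetric])
      (use in_E_bounds[OF E] in_E_integrable[OF E, of 0 1] in \<open>auto simp: has_integral_integral\<close>)
  also have "\<dots> = emeasure (lborel \<Otimes>\<^sub>M lborel) A"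
    by (simp add: lborel.emeasure_pair_measure_alt[OF A] x_sections)
  also have "\<dots> = (\<integral>\<^sup>+y. ennreal (indicator {0..1} y * pinv0 f y) \<partial>lborel)"
    by (simp add: lborel_pair.emeasure_pair_measure_alt2[OF A] y_sections)
  also have "\<dots> = ennreal (integral {0..1} (pinv0 f))"
    by (rule nn_integral_has_integral_lebesgue)
      (use pinv0_nonneg[OF E] pinv0_integrable[OF E, of 0 1] in \<open>auto simp: has_integral_integral\<close>)
  finally have "ennreal (integral {0..1} f) = ennreal (integral {0..1} (pinv0 f))" .
  then show ?thesis
    using pinv0_nonneg[OF E] E by (simp add: integral_nonneg pinv0_integrable in_E_def)
qed

section \<open>Basic properties of \<open>Top\<close> and invariance of \<open>in_E\<close>\<close>

lemma integral_in_E_pos: "in_E f \<Longrightarrow> 0 < integral {0..1} f"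
  by (simp add: in_E_def)

lemma Top_eq_0: "1 \<le> x \<Longrightarrow> Top f x = 0"
  by (cases "x = 1") (auto simp: Top_def)

lemma Top_0: "in_E f \<Longrightarrow> Top f 0 = 1"
  using integral_in_E_pos[of f] by (simp add: Top_pinv0 integral_pinv0)

text \<open>Past 1 the interval \<open>{x..1}\<close> is empty and \<open>p\<close> vanishes, so
  both sides stay equal; rescaled arguments \<open>x / a\<close> may therefore leave the unit
  interval.\<close>

lemma integral_tail_diff:
  fixes p :: "real \<Rightarrow> real"
  assumes int: "\<And>a b. p integrable_on {a..b}" and zero: "\<And>t. 1 < t \<Longrightarrow> p t = 0" and "x \<le> y"
  shows "integral {x..1} p - integral {y..1} p = integral {x..y} p"
proof (cases "y \<le> 1")
  case True
  then show ?thesis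
    using Henstock_Kurzweil_Integration.integral_combine[OF \<open>x \<le> y\<close> True int] by simp
next
  case y: False
  have nil: "integral {u..y} p = 0" if "1 \<le> u" for u
  proof -
    \<comment> \<open>When \<open>u = 1\<close>, the value of \<open>p\<close> at 1 may be nonzero,
      so this single point is removed as negligible.\<close>
    have "integral {u..y} p = integral {u..y} (\<lambda>_. 0)"
      by (rule integral_spike[of "{1}"]) (use zero that in auto)
    then show ?thesis by simp
  qed
  show ?thesis
  proof (cases "x \<le> 1")
    case True
    then show ?thesis
      using Henstock_Kurzweil_Integration.integral_combine[OF True _ int, of y] nil[of 1] y by simp
  next
    case False
    then show ?thesis
      using y nil[of x] by simp
  qed
qed

lemma Top_diff:
  assumes "in_E f" "x \<le> y"
  shows "Top f x - Top f y = integral {x..y} (pinv0 f) / integral {0..1} f"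
  using integral_tail_diff[OF pinv0_integrable[OF assms(1)] _ assms(2)]
  by (simp add: Top_pinv0 pinv0_def flip: diff_divide_distrib)

lemma Top_antimono:
  assumes "in_E f" "x \<le> y"
  shows "Top f y \<le> Top f x"
proof -
  have "0 \<le> integral {x..y} (pinv0 f) / integral {0..1} f"
    using assms by (intro divide_nonneg_pos integral_nonneg pinv0_integrable integral_in_E_pos)
      (auto simp: pinv0_nonneg)
  then show ?thesis
    using Top_diff[OF assms] by simp
qed

lemma Top_continuous:
  assumes "in_E f"
  shows "continuous_on {0..1} (Top f)"
proof -
  have "continuous_on {0..1} (\<lambda>x. integral {x..1} (pinv0 f) / integral {0..1} f)"
    using integral_in_E_pos[OF assms]
    by (intro continuous_intros indefinite_integral_continuous_1' pinv0_integrable assms) auto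
  then show ?thesis
    by (simp add: Top_pinv0[abs_def])
qed

lemma in_E_continuousI:
  assumes "continuous_on {0..1} f" "\<And>x y. 0 \<le> x \<Longrightarrow> x \<le> y \<Longrightarrow> y \<le> 1 \<Longrightarrow> f y \<le> f x"
    and "f 0 = 1" "0 \<le> f 1"
  shows "in_E f"
proof -
  have nn: "0 \<le> f x" if "x \<in> {0..1}" for x
    using assms(2)[of x 1] assms(4) that by auto
  have "integral {0..1} f \<noteq> 0"
    using integral_eq_0_iff[OF assms(1) _ nn] assms(3) by auto
  moreover have "0 \<le> integral {0..1} f"
    using nn assms(1) by (intro integral_nonneg integrable_continuous_interval)
  ultimately show ?thesis
    using assms nn continuous_imp_measurable_on_sets_lebesgue[OF assms(1)]
    by (auto simp: in_E_def)
qed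

lemma Top_in_E: "in_E f \<Longrightarrow> in_E (Top f)"
  by (rule in_E_continuousI) (auto simp: Top_continuous Top_antimono Top_0 Top_eq_0)

section \<open>Continuous strictly decreasing functions and their inverses\<close>

text \<open>Vanishing beyond 1 gives the rescaled copies \<open>f (x / a)\<close> a meaning on the
  whole half-line; two applications of \<open>Top\<close> turn every member of \<open>in_E\<close>
  into such a function.\<close>

definition profile :: "(real \<Rightarrow> real) \<Rightarrow> bool" where
  "profile f \<longleftrightarrow> continuous_on {0..1} f \<and> strict_antimono_on {0..1} f \<and> f 0 = 1 \<and> (\<forall>x\<ge>1. f x = 0)"

lemma profile_less: "profile f \<Longrightarrow> 0 \<le> x \<Longrightarrow> x < y \<Longrightarrow> y \<le> 1 \<Longrightarrow> f y < f x"
  by (auto simp: profile_def monotone_on_def)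

lemma profile_in_E:
  assumes "profile f"
  shows "in_E f"
proof (rule in_E_continuousI)
  show "f y \<le> f x" if "0 \<le> x" "x \<le> y" "y \<le> 1" for x y
    using profile_less[OF assms, of x y] that by (cases "x = y") auto
qed (use assms in \<open>auto simp: profile_def\<close>)

lemma profile_bounds:
  assumes "profile f" "0 \<le> x"
  shows "0 \<le> f x" "f x \<le> 1"
  using in_E_bounds[OF profile_in_E[OF assms(1)] assms(2)] assms(1)
  by (cases "x \<le> 1"; auto simp: profile_def)+

lemma profile_pos: "profile f \<Longrightarrow> 0 \<le> x \<Longrightarrow> x < 1 \<Longrightarrow> 0 < f x"
  using profile_less[of f x 1] by (auto simp: profile_def)

lemma profile_pinv:
  assumes f: "profile f" and "0 \<le> y" "y \<le> 1"
  shows "f (pinv f y) = y"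
proof -
  obtain x where x: "0 \<le> x" "x \<le> 1" "f x = y"
    using IVT2'[of f 1 y 0] f assms by (auto simp: profile_def)
  have "pinv f y = x"
    unfolding pinv_def
  proof (rule cSup_eq_maximum)
    show "x \<in> {x \<in> {0..1}. y \<le> f x}"
      using x by auto
    show "t \<le> x" if "t \<in> {x \<in> {0..1}. y \<le> f x}" for t
      using that x profile_less[OF f, of x t] by (cases "t \<le> x") auto
  qed
  with x show ?thesis by simp
qed

lemma profile_pinv0_le:
  assumes "profile f" "0 \<le> y"
  shows "f (pinv0 f y) \<le> y"
  using assms profile_pinv[of f y] by (auto simp: pinv0_def profile_def)

lemma less_pinv0_imp:
  assumes f: "profile f" and "0 \<le> u" "0 \<le> w" "w < pinv0 f u"
  shows "u < f w"
proof -
  have "u \<le> 1"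
    using assms by (auto simp: pinv0_def split: if_splits)
  then show ?thesis
    using assms profile_pinv[OF f, of u] pinv_bounds[OF profile_in_E[OF f], of u]
      profile_less[OF f, of w "pinv f u"] by (simp add: pinv0_def)
qed

text \<open>At \<open>u = 0\<close> the conclusion would fail, since \<open>pinv0 f 0\<close> is 1
  and \<open>f\<close> is 0 beyond 1; hence the strict \<open>0 < u\<close>.\<close>

lemma pinv0_less_imp:
  assumes f: "profile f" and "0 < u" "0 \<le> w" "pinv0 f u < w"
  shows "f w < u"
proof (cases "u \<le> 1 \<and> w \<le> 1")
  case True
  then show ?thesis
    using assms profile_pinv[OF f, of u] pinv_bounds[OF profile_in_E[OF f], of u]
      profile_less[OF f, of "pinv f u" w] by (simp add: pinv0_def)
next
  case False
  then show ?thesis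
    using assms profile_bounds[OF f, of w] by (auto simp: profile_def)
qed

section \<open>The sign-change relation and its invariance under \<open>Top\<close>\<close>

definition crossing_le :: "(real \<Rightarrow> real) \<Rightarrow> (real \<Rightarrow> real) \<Rightarrow> bool" where
  "crossing_le f g \<longleftrightarrow>
     (\<forall>a>0. \<forall>b>0. \<forall>x y z. 0 \<le> x \<and> x < y \<and> y < z \<and> g x < b * f (x / a) \<and> b * f (y / a) < g y
        \<longrightarrow> b * f (z / a) \<le> g z)"

lemma crossing_leD:
  assumes "crossing_le f g" "0 < a" "0 < b" "0 \<le> x" "x < y" "y < z"
    and "g x < b * f (x / a)" "b * f (y / a) < g y"
  shows "b * f (z / a) \<le> g z"
  using assms unfolding crossing_le_def by blast

text \<open>Reflect in the diagonal: a strict sign at \<open>t\<close> of \<open>pinv0 g\<close>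
  minus the scaled \<open>pinv0 f\<close> carries over to the point \<open>pinv0 g t\<close> for
  \<open>g\<close> minus \<open>f\<close> scaled with \<open>a\<close> and \<open>b\<close>
  exchanged. The points come in reverse order, and the pattern minus, plus, minus is its own
  reversal.\<close>

lemma crossing_le_pinv0:
  assumes f: "profile f" and g: "profile g" and le: "crossing_le f g"
  shows "crossing_le (pinv0 f) (pinv0 g)"
  unfolding crossing_le_def
proof (intro allI impI, elim conjE, rule ccontr)
  fix a b x y z :: real
  assume ab: "0 < a" "0 < b" and xyz: "0 \<le> x" "x < y" "y < z"
    and gx: "pinv0 g x < b * pinv0 f (x / a)" and gy: "b * pinv0 f (y / a) < pinv0 g y"
    and "\<not> b * pinv0 f (z / a) \<le> pinv0 g z"
  then have gz: "pinv0 g z < b * pinv0 f (z / a)"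
    by simp
  have nonneg: "0 \<le> pinv0 g t" "0 \<le> pinv0 f t" for t
    using f g by (auto intro: pinv0_nonneg profile_in_E)
  have minus: "g (pinv0 g t) < a * f (pinv0 g t / b)"
    if "0 \<le> t" "pinv0 g t < b * pinv0 f (t / a)" for t
  proof -
    have "t / a < f (pinv0 g t / b)"
      using that ab nonneg by (intro less_pinv0_imp[OF f]) (auto simp: field_simps)
    then show ?thesis
      using profile_pinv0_le[OF g that(1)] ab by (simp add: field_simps)
  qed
  have plus: "a * f (pinv0 g y / b) < g (pinv0 g y)"
  proof -
    have "f (pinv0 g y / b) < y / a"
      using gy xyz ab nonneg by (intro pinv0_less_imp[OF f]) (auto simp: field_simps)
    \<comment> \<open>A plus sign means \<open>pinv0 g y > 0\<close>, which excludes
      \<open>y > 1\<close>; only then is \<open>g (pinv0 g y)\<close> exactly \<open>y\<close>. The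
      minus case gets by with the inequality \<open>profile_pinv0_le\<close>.\<close>
    moreover have "y \<le> 1"
    proof (rule ccontr)
      assume "\<not> y \<le> 1"
      then have "pinv0 g y = 0"
        by (simp add: pinv0_def)
      moreover have "0 \<le> b * pinv0 f (y / a)"
        using nonneg ab by simp
      ultimately show False
        using gy by linarith
    qed
    ultimately show ?thesis
      using profile_pinv[OF g, of y] xyz ab by (simp add: field_simps pinv0_def)
  qed
  have mono: "pinv0 g z \<le> pinv0 g y" "pinv0 g y \<le> pinv0 g x"
    using pinv0_antimono[OF profile_in_E[OF g], of UNIV] xyz by (auto simp: monotone_on_def)
  have mx: "g (pinv0 g x) < a * f (pinv0 g x / b)" and mz: "g (pinv0 g z) < a * f (pinv0 g z / b)"
    using minus[of x] minus[of z] gx gz xyz by auto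
  have "pinv0 g z \<noteq> pinv0 g y" "pinv0 g y \<noteq> pinv0 g x"
    using plus mx mz by auto
  then have "a * f (pinv0 g x / b) \<le> g (pinv0 g x)"
    using mono mz plus nonneg ab
    by (intro crossing_leD[OF le, of b a "pinv0 g z" "pinv0 g y" "pinv0 g x"]) auto
  with mx show False
    by simp
qed

lemma integral_rescale:
  fixes p :: "real \<Rightarrow> real"
  assumes "0 < a"
  shows "integral {u..v} (\<lambda>t. p (t / a)) = a * integral {u / a..v / a} p"
proof (cases "u \<le> v")
  case True
  have "(\<lambda>x. x / (1 / a)) ` {u / a..v / a} = {u..v}"
    using assms True by (subst image_divide_atLeastAtMost) (auto simp: field_simps)
  then show ?thesis
    using integral_stretch_real[of "1 / a" "u / a" "v / a" p] assms by simp
next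
  case False
  then show ?thesis
    using assms by (simp add: divide_strict_right_mono)
qed

lemma integrable_rescale:
  fixes p :: "real \<Rightarrow> real"
  assumes "0 < a" "p integrable_on {u / a..v / a}" "u \<le> v"
  shows "(\<lambda>t. p (t / a)) integrable_on {u..v}"
proof -
  have "(\<lambda>x. x / (1 / a)) ` {u / a..v / a} = {u..v}"
    using assms by (subst image_divide_atLeastAtMost) (auto simp: field_simps)
  then show ?thesis
    using integrable_stretch_real[OF assms(2), of "1 / a"] assms by simp
qed

text \<open>
  As both tails vanish far out, each sign change of their difference, and the return to zero,
  forces a sign of the difference of the integrands.
\<close>

lemma crossing_le_tail:
  fixes p q :: "real \<Rightarrow> real"
  assumes p: "\<And>a b. p integrable_on {a..b}" "\<And>t. 1 < t \<Longrightarrow> p t = 0"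
    and q: "\<And>a b. q integrable_on {a..b}" "\<And>t. 1 < t \<Longrightarrow> q t = 0"
    and le: "crossing_le p q" and "0 < C" "0 < c"
  shows "crossing_le (\<lambda>x. integral {x..1} p / C) (\<lambda>x. integral {x..1} q / c)"
  unfolding crossing_le_def
proof (intro allI impI, elim conjE, rule ccontr)
  fix a b x y z :: real
  assume ab: "0 < a" "0 < b" and xyz: "0 \<le> x" "x < y" "y < z"
    and signs: "integral {x..1} q / c < b * (integral {x / a..1} p / C)"
      "b * (integral {y / a..1} p / C) < integral {y..1} q / c"
      "\<not> b * (integral {z / a..1} p / C) \<le> integral {z..1} q / c"
  \<comment> \<open>\<open>D\<close> will be \<open>c\<close> times the difference of the two tails,
    and \<open>d\<close> plays the role of minus its derivative, with the factor
    \<open>1 / a\<close> coming from the inner rescaling.\<close>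
  define B where "B = b * c / C"
  have "0 < B"
    using ab assms by (simp add: B_def)
  define D where "D u = integral {u..1} q - B * integral {u / a..1} p" for u
  define d where "d t = q t - B / a * p (t / a)" for t
  have D: "D x < 0" "0 < D y" "D z < 0"
    using signs \<open>0 < C\<close> \<open>0 < c\<close> by (simp_all add: D_def B_def field_simps)
  have int: "(\<lambda>t. B / a * p (t / a)) integrable_on {u..v}" if "u \<le> v" for u v
    using ab p that by (intro integrable_on_mult_right integrable_rescale) auto
  have int_d: "d integrable_on {u..v}" if "u \<le> v" for u v
    unfolding d_def by (intro integrable_diff int q that)
  have diff: "D u - D v = integral {u..v} d" if "u \<le> v" for u v
  proof -
    have "integral {u..v} d = integral {u..v} q - B / a * integral {u..v} (\<lambda>t. p (t / a))"
      unfolding d_def by (simp only: integral_diff[OF q(1) int[OF that]] integral_mult_right)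
    also have "\<dots> = integral {u..v} q - B * integral {u / a..v / a} p"
      using ab by (simp add: integral_rescale)
    finally show ?thesis
      using integral_tail_diff[OF q that] integral_tail_diff[OF p, of "u / a" "v / a"] that ab
      by (simp add: D_def divide_right_mono flip: right_diff_distrib) (simp add: algebra_simps)
  qed
  have neg: "\<exists>t\<in>{u..v}. d t < 0" if "u \<le> v" "D u < D v" for u v
  proof (rule ccontr)
    assume "\<not> ?thesis"
    then have "0 \<le> integral {u..v} d"
      using int_d that by (intro integral_nonneg) (auto simp: not_less)
    then show False
      using diff[OF that(1)] that(2) by simp
  qed
  have pos: "\<exists>t\<in>{u..v}. 0 < d t" if "u \<le> v" "D v < D u" for u v
  proof (rule ccontr)
    assume "\<not> ?thesis"
    then have "integral {u..v} d \<le> integral {u..v} (\<lambda>_. 0)"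
      using int_d that by (intro integral_le) (auto simp: not_less)
    then show False
      using diff[OF that(1)] that(2) by simp
  qed
  define M where "M = max z (max 1 a)"
  have M: "z \<le> M" "1 \<le> M" "1 \<le> M / a"
    using ab by (auto simp: M_def field_simps)
  have "integral {M..1} q = 0" "integral {M / a..1} p = 0"
    using M by (cases "M = 1"; cases "M / a = 1"; auto)+
  then have "D M = 0"
    by (simp add: D_def)
  obtain t1 where t1: "x \<le> t1" "t1 \<le> y" "d t1 < 0"
    using neg[of x y] xyz D by auto
  obtain t2 where t2: "y \<le> t2" "t2 \<le> z" "0 < d t2"
    using pos[of y z] xyz D by auto
  obtain t3 where t3: "z \<le> t3" "d t3 < 0"
    using neg[of z M] M D \<open>D M = 0\<close> by auto
  have "t1 \<noteq> t2" "t2 \<noteq> t3"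
    using t1 t2 t3 by auto
  then have "B / a * p (t3 / a) \<le> q t3"
    using t1 t2 t3 ab xyz \<open>0 < B\<close>
    by (intro crossing_leD[OF le, of a "B / a" t1 t2 t3]) (auto simp: d_def)
  with t3 show False
    by (simp add: d_def)
qed

lemma crossing_le_Top_pinv0:
  assumes "in_E f" "in_E g" "crossing_le (pinv0 f) (pinv0 g)"
  shows "crossing_le (Top f) (Top g)"
  unfolding Top_pinv0[abs_def]
  by (intro crossing_le_tail pinv0_integrable integral_in_E_pos assms) (auto simp: pinv0_def)

lemma crossing_le_Top:
  assumes "profile f" "profile g" "crossing_le f g"
  shows "crossing_le (Top f) (Top g)"
  using assms by (intro crossing_le_Top_pinv0 crossing_le_pinv0 profile_in_E)

lemma in_E_one: "in_E (\<lambda>_. 1)"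
  by (rule in_E_continuousI) auto

lemma crossing_le_Top_one:
  assumes "in_E f"
  shows "crossing_le (Top (\<lambda>_. 1)) (Top f)"
proof (rule crossing_le_Top_pinv0[OF in_E_one assms])
  have one: "pinv0 (\<lambda>_. 1) y = (if y \<le> 1 then 1 else 0)" for y
    using pinv_ge[of 1 y "\<lambda>_. 1"] pinv_bounds(2)[OF in_E_one, of y] by (auto simp: pinv0_def)
  show "crossing_le (pinv0 (\<lambda>_. 1)) (pinv0 f)"
    unfolding crossing_le_def
  proof (intro allI impI, elim conjE, rule ccontr)
    fix a b x y z :: real
    assume ab: "0 < a" "0 < b" and xyz: "0 \<le> x" "x < y" "y < z"
      and signs: "pinv0 f x < b * pinv0 (\<lambda>_. 1) (x / a)" "b * pinv0 (\<lambda>_. 1) (y / a) < pinv0 f y"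
        "\<not> b * pinv0 (\<lambda>_. 1) (z / a) \<le> pinv0 f z"
    \<comment> \<open>A minus sign at \<open>z\<close> puts all three points where the step has
      height \<open>b\<close>; a decreasing function cannot rise above \<open>b\<close> after lying
      below it.\<close>
    have "z / a \<le> 1"
      using signs(3) pinv0_nonneg[OF assms, of z] by (auto simp: one split: if_splits)
    then have "x / a \<le> 1" "y / a \<le> 1"
      using ab xyz by (auto simp: field_simps)
    moreover have "pinv0 f y \<le> pinv0 f x"
      using pinv0_antimono[OF assms, of UNIV] xyz by (auto simp: monotone_on_def)
    ultimately show False
      using signs by (simp add: one)
  qed
qed

text \<open>Continuity and \<open>f 0 = 1\<close> let \<open>f\<close> reach every level below 1 at
  some positive point, so \<open>pinv0 f\<close> is positive on the open interval and its tail
  integral decreases strictly.\<close>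

lemma profile_Top:
  assumes E: "in_E f" and cont: "continuous_on {0..1} f"
  shows "profile (Top f)"
proof -
  have pinv_pos: "0 < pinv0 f m" if m: "0 < m" "m < 1" for m
  proof (cases "m \<le> f 1")
    case True
    then show ?thesis
      using pinv_ge[of 1 m f] m by (simp add: pinv0_def)
  next
    case False
    then obtain x where x: "0 \<le> x" "x \<le> 1" "f x = m"
      using IVT2'[of f 1 m 0] cont E m by (auto simp: in_E_def)
    moreover have "x \<noteq> 0"
      using x E m by (auto simp: in_E_def)
    ultimately show ?thesis
      using pinv_ge[of x m f] m by (simp add: pinv0_def)
  qed
  have "Top f y < Top f x" if xy: "0 \<le> x" "x < y" "y \<le> 1" for x y
  proof -
    define m where "m = (x + y) / 2"
    have m: "x < m" "m < y" "0 < m" "m < 1"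
      using xy by (auto simp: m_def)
    have "0 < (m - x) * pinv0 f m"
      using m pinv_pos by simp
    also have "\<dots> = integral {x..m} (\<lambda>_. pinv0 f m)"
      using m by simp
    also have "\<dots> \<le> integral {x..m} (pinv0 f)"
      using pinv0_antimono[OF E, of UNIV]
      by (intro integral_le pinv0_integrable[OF E]) (auto simp: monotone_on_def)
    finally have "0 < Top f x - Top f m"
      using m integral_in_E_pos[OF E] by (simp add: Top_diff[OF E])
    then show ?thesis
      using Top_antimono[OF E, of m y] m by simp
  qed
  then show ?thesis
    using E by (auto simp: profile_def monotone_on_def Top_continuous Top_0 Top_eq_0)
qed

section \<open>Pointwise and integral bounds from the sign-change relation\<close>

text \<open>Were \<open>g x > f x\<close>, then for \<open>b\<close> slightly above 1 the copy
  \<open>b * f (t / b)\<close> would lie above \<open>g\<close> at 0, below it at \<open>x\<close>,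
  and above it at 1, where \<open>g\<close> vanishes and the copy is still positive.\<close>

lemma crossing_le_imp_ge:
  assumes f: "profile f" and g: "profile g" and le: "crossing_le f g" and x: "0 \<le> x"
  shows "g x \<le> f x"
proof (rule ccontr)
  assume less: "\<not> g x \<le> f x"
  have "x \<noteq> 0" "x < 1"
    using less f g by (auto simp: profile_def intro: ccontr)
  then have x01: "0 < x" "x < 1"
    using x by auto
  have "isCont f x"
    using f x01 by (intro continuous_on_interior[of "{0..1}"]) (auto simp: profile_def)
  moreover have "((\<lambda>b. x / b) \<longlongrightarrow> x / 1) (at_right 1)"
    by (intro tendsto_intros) auto
  ultimately have "((\<lambda>b. b * f (x / b)) \<longlongrightarrow> 1 * f x) (at_right 1)"
    by (intro tendsto_intros isCont_tendsto_compose[of _ f]) auto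
  then have "\<forall>\<^sub>F b in at_right 1. b * f (x / b) < g x"
    using less by (intro order_tendstoD) auto
  moreover have "\<forall>\<^sub>F b in at_right (1::real). 1 < b"
    by (simp add: eventually_at_right_less)
  ultimately have "\<forall>\<^sub>F b in at_right 1. 1 < b \<and> b * f (x / b) < g x"
    by eventually_elim auto
  then obtain b where b: "1 < b" "b * f (x / b) < g x"
    using eventually_happens'[OF trivial_limit_at_right_real] by blast
  have "b * f (1 / b) \<le> g 1"
    using b x01 f g by (intro crossing_leD[OF le, of b b 0 x 1]) (auto simp: profile_def)
  moreover have "0 < b * f (1 / b)"
    using profile_pos[OF f, of "1 / b"] b by simp
  ultimately show False
    using g by (simp add: profile_def)
qed

text \<open>
  The factor is the ratio of the slopes of \<open>Top f\<close> and \<open>Top g\<close> at the origin. For a smaller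
  factor \<open>a\<close>, the copy of \<open>Top f\<close> starts below \<open>Top g\<close>; after scaling it up a little, it
  cannot lie above \<open>Top g\<close> again later on.
\<close>

lemma Top_le_rescaled_Top:
  assumes f: "profile f" and g: "profile g" and le: "crossing_le (Top f) (Top g)"
    and \<rho>: "\<rho> = integral {0..1} g / integral {0..1} f" and x: "0 \<le> x"
  shows "Top f x \<le> Top g (\<rho> * x)"
proof (rule ccontr)
  assume less: "\<not> Top f x \<le> Top g (\<rho> * x)"
  note Ef = profile_in_E[OF f] and Eg = profile_in_E[OF g]
  have F: "profile (Top f)" and G: "profile (Top g)"
    using f g by (auto intro!: profile_Top Ef Eg) (auto simp: profile_def)
  have If: "0 < integral {0..1} f" and Ig: "0 < integral {0..1} g"
    using Ef Eg integral_in_E_pos by auto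
  then have \<rho>_pos: "0 < \<rho>"
    by (simp add: \<rho>)
  have "x \<noteq> 0"
    using less F G by (auto simp: profile_def)
  moreover have "x < 1"
    using less profile_bounds(1)[OF G, of "\<rho> * x"] \<rho>_pos x Top_eq_0[of x f] by (cases "x < 1") auto
  ultimately have x01: "0 < x" "x < 1"
    using x by auto
  define z where "z = \<rho> * x"
  have z: "0 < z"
    using x01 \<rho>_pos by (simp add: z_def)
  have "isCont (Top f) x"
    using F x01 by (intro continuous_on_interior[of "{0..1}"]) (auto simp: profile_def)
  \<comment> \<open>Here \<open>z / \<rho> = x\<close>, so by continuity the assumed violation
    survives for \<open>a\<close> slightly below \<open>\<rho>\<close>.\<close>
  moreover have "((\<lambda>a. z / a) \<longlongrightarrow> z / \<rho>) (at_left \<rho>)"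
    using \<rho>_pos by (intro tendsto_intros) auto
  ultimately have "((\<lambda>a. Top f (z / a)) \<longlongrightarrow> Top f x) (at_left \<rho>)"
    using \<rho>_pos by (intro isCont_tendsto_compose[of _ "Top f"]) (auto simp: z_def)
  then have "\<forall>\<^sub>F a in at_left \<rho>. Top g z < Top f (z / a)"
    using less by (intro order_tendstoD) (auto simp: z_def)
  moreover have "\<forall>\<^sub>F a in at_left \<rho>. a \<in> {0<..<\<rho>}"
    using \<rho>_pos by (rule eventually_at_left_real)
  ultimately have "\<forall>\<^sub>F a in at_left \<rho>. Top g z < Top f (z / a) \<and> a \<in> {0<..<\<rho>}"
    by eventually_elim auto
  then have "\<exists>a. Top g z < Top f (z / a) \<and> a \<in> {0<..<\<rho>}"
    by (rule eventually_happens'[OF trivial_limit_at_left_real])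
  then obtain a where a: "0 < a" "a < \<rho>" "Top g z < Top f (z / a)"
    by auto
  \<comment> \<open>Up to height \<open>f u\<close> the inverse of \<open>f\<close> is at least
    \<open>u\<close>, so there \<open>Top f\<close> falls at rate at least
    \<open>u / integral {0..1} f\<close>, while \<open>Top g\<close> falls at rate at most
    \<open>1 / integral {0..1} g\<close>. The choice \<open>a / \<rho> < u\<close> then makes
    \<open>Top f w\<close> smaller than \<open>Top g (a * w)\<close>.\<close>
  obtain u where u: "a / \<rho> < u" "u < 1"
    using dense[of "a / \<rho>" 1] a \<rho>_pos by auto
  moreover have "0 < a / \<rho>"
    using a \<rho>_pos by simp
  ultimately have u: "a / \<rho> < u" "0 < u" "u < 1"
    by linarith+
  \<comment> \<open>The bound \<open>z / (2 * a)\<close> keeps \<open>a * w\<close> left of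
    \<open>z\<close>.\<close>
  define w where "w = min (f u) (z / (2 * a))"
  have w: "0 < w" "w \<le> f u" "a * w < z"
    using profile_pos[OF f, of u] u z a by (auto simp: w_def min_def field_simps)
  have w1: "w \<le> 1"
    using w profile_bounds[OF f, of u] u by simp
  have "u \<le> pinv0 f w"
    using pinv_ge[of u w f] u w w1 by (simp add: pinv0_def)
  define y where "y = a * w"
  have y: "0 < y" "y < z" "y / a = w"
    using w a by (auto simp: y_def)
  have "Top g 0 - Top g y \<le> y / integral {0..1} g"
  proof -
    have "integral {0..y} (pinv0 g) \<le> integral {0..y} (\<lambda>_. 1)"
      using pinv0_le_1[OF Eg] by (intro integral_le pinv0_integrable[OF Eg]) auto
    then show ?thesis
      using Top_diff[OF Eg, of 0 y] y Ig by (simp add: divide_right_mono)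
  qed
  also have "y / integral {0..1} g < w * u / integral {0..1} f"
    using u w a Ig If by (simp add: y_def \<rho> field_simps)
  also have "\<dots> \<le> Top f 0 - Top f w"
  proof -
    have "w * u = integral {0..w} (\<lambda>_. u)"
      using w by simp
    also have "\<dots> \<le> integral {0..w} (pinv0 f)"
    proof (intro integral_le pinv0_integrable[OF Ef])
      show "u \<le> pinv0 f t" if "t \<in> {0..w}" for t
        using pinv0_antimono[OF Ef, of UNIV] that \<open>u \<le> pinv0 f w\<close>
        by (auto simp: monotone_on_def intro: order_trans)
    qed auto
    finally show ?thesis
      using Top_diff[OF Ef, of 0 w] w If by (simp add: divide_right_mono)
  qed
  finally have FG: "Top f w < Top g y"
    using Ef Eg by (simp add: Top_0)
  \<comment> \<open>With half the gap as margin, scaling by \<open>1 + e\<close> lifts the copy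
    above \<open>Top g\<close> at 0 and keeps it below at \<open>y\<close>, because
    \<open>Top f w \<le> 1\<close>.\<close>
  define e where "e = (Top g y - Top f w) / 2"
  have e: "0 < e" "Top g y = Top f w + 2 * e"
    using FG by (auto simp: e_def field_simps)
  define b where "b = 1 + e"
  have b: "1 < b"
    using e by (simp add: b_def)
  have "e * Top f w \<le> e * 1"
    using e profile_bounds[OF F, of w] w by (intro mult_left_mono) auto
  then have bw: "b * Top f w < Top g y"
    using e by (simp add: b_def distrib_right)
  have "b * Top f (z / a) \<le> Top g z"
    using a b bw y Ef Eg
    by (intro crossing_leD[OF le, of a b 0 y z]) (auto simp: Top_0)
  moreover have "0 \<le> Top f (z / a)"
    using profile_bounds[OF F] z a by simp
  then have "Top f (z / a) \<le> b * Top f (z / a)"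
    using b by (simp add: mult_le_cancel_right1)
  ultimately show False
    using a by simp
qed

text \<open>Substitute \<open>t = \<rho> * x\<close> in the bound on \<open>F\<close>. The remainder
  over \<open>{\<rho>..1}\<close> is kept because it decides the equality case later.\<close>

lemma integral_rescaled_le:
  assumes F: "profile F" and G: "profile G" and \<rho>: "0 < \<rho>" "\<rho> \<le> 1"
    and le: "\<And>x. 0 \<le> x \<Longrightarrow> F x \<le> G (\<rho> * x)"
  shows "\<rho> * integral {0..1} F + integral {\<rho>..1} G \<le> integral {0..1} G"
proof -
  note intG = in_E_integrable[OF profile_in_E[OF G]] and intF = in_E_integrable[OF profile_in_E[OF F]]
  have "\<rho> * integral {0..1} F = integral {0..\<rho>} (\<lambda>t. F (t / \<rho>))"
    using integral_rescale[OF \<rho>(1), of 0 \<rho> F] \<rho> by simp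
  also have "\<dots> \<le> integral {0..\<rho>} G"
  proof (intro integral_le)
    show "(\<lambda>t. F (t / \<rho>)) integrable_on {0..\<rho>}"
      using \<rho> intF by (intro integrable_rescale) auto
    show "G integrable_on {0..\<rho>}"
      using \<rho> intG by auto
    show "F (t / \<rho>) \<le> G t" if "t \<in> {0..\<rho>}" for t
      using le[of "t / \<rho>"] \<rho> that by simp
  qed
  finally show ?thesis
    using Henstock_Kurzweil_Integration.integral_combine[of 0 \<rho> 1 G] \<rho> intG by simp
qed

section \<open>Iterates of \<open>Top\<close> and convergence of \<open>hseq\<close>\<close>

lemma in_E_Top_funpow: "in_E g \<Longrightarrow> in_E ((Top ^^ n) g)"
  by (induction n) (auto intro: Top_in_E)

text \<open>One application makes the function continuous, and from a continuous one the next makes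
  it strictly decreasing.\<close>

lemma profile_Top_funpow:
  assumes "in_E g" "2 \<le> n"
  shows "profile ((Top ^^ n) g)"
proof -
  obtain k where "n = Suc (Suc k)"
    using assms(2) by (metis Suc_le_D numeral_2_eq_2 Suc_le_mono)
  then show ?thesis
    using in_E_Top_funpow[OF assms(1), of k] in_E_Top_funpow[OF assms(1), of "Suc k"]
    by (auto intro!: profile_Top Top_continuous)
qed

lemma hseq_Suc: "hseq (Suc n) = Top (hseq n)"
  by (simp add: hseq_def)

text \<open>The constant \<open>hseq 0\<close> is already continuous, so one application suffices;
  it does not vanish beyond 1, so the index starts at 1.\<close>

lemma profile_hseq: "profile (hseq (Suc n))"
proof (cases n)
  case 0
  then show ?thesis
    by (auto simp: hseq_def intro!: profile_Top in_E_one)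
next
  case (Suc m)
  then show ?thesis
    unfolding hseq_def by (intro profile_Top_funpow in_E_one) auto
qed

text \<open>Apply \<open>Top\<close> to both sides repeatedly, starting from
  \<open>crossing_le_Top_one\<close>. The offset 2 ensures that every iterate of \<open>g\<close>
  fed to \<open>crossing_le_Top\<close> is a \<open>profile\<close>.\<close>

lemma crossing_le_hseq:
  assumes "in_E g" "n + 2 \<le> i"
  shows "crossing_le (hseq (Suc n)) ((Top ^^ i) g)"
  using assms(2)
proof (induction n arbitrary: i)
  case 0
  then obtain j where "i = Suc j"
    by (cases i) auto
  then show ?case
    using crossing_le_Top_one[OF in_E_Top_funpow[OF assms(1), of j]] by (simp add: hseq_def)
next
  case (Suc n)
  then obtain j where j: "i = Suc j" "n + 2 \<le> j"
    by (cases i) auto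
  then show ?case
    using crossing_le_Top[OF profile_hseq profile_Top_funpow[OF assms(1)] Suc.IH, of j]
    by (simp add: hseq_Suc)
qed

text \<open>The sequence is itself an orbit of \<open>Top\<close>, so
  \<open>crossing_le_hseq\<close> with the constant 1 as \<open>g\<close> compares consecutive
  members.\<close>

lemma hseq_antimono:
  assumes "0 \<le> x"
  shows "hseq (Suc (Suc n)) x \<le> hseq (Suc n) x"
proof -
  have "crossing_le (hseq (Suc n)) (hseq (Suc (Suc n)))"
    using crossing_le_hseq[OF in_E_one, of n "Suc (Suc n)"] by (simp add: hseq_def)
  then show ?thesis
    using crossing_le_imp_ge profile_hseq assms by blast
qed

lemma hseq_tendsto_hlim:
  assumes "0 \<le> x"
  shows "(\<lambda>n. hseq (Suc n) x) \<longlonglongrightarrow> hlim x"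
proof -
  have "decseq (\<lambda>n. hseq (Suc n) x)"
    by (rule decseq_SucI) (rule hseq_antimono[OF assms])
  then obtain l where "(\<lambda>n. hseq (Suc n) x) \<longlonglongrightarrow> l"
    using decseq_convergent[of _ 0] profile_bounds(1)[OF profile_hseq assms] by blast
  moreover from this have "hlim x = l"
    unfolding hlim_def by (intro limI) (rule LIMSEQ_imp_Suc)
  ultimately show ?thesis
    by simp
qed

section \<open>Periodic points and the passage to the limit\<close>

theorem theorem4p9:
  fixes r :: nat and g :: "real \<Rightarrow> real"
  assumes "r \<ge> 1"
    and "in_E g"
    and "\<forall>x\<in>{0..1}. (Top ^^ r) g x = g x"
  shows "\<forall>x\<in>{0..1}. g x = hlim x"
proof -
  define G where "G i = (Top ^^ i) g" for i
  have G_Suc: "G (Suc i) = Top (G i)" for i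
    by (simp add: G_def)
  have profile_G: "profile (G i)" if "2 \<le> i" for i
    using profile_Top_funpow[OF assms(2) that] by (simp add: G_def)
  \<comment> \<open>Periodicity is given on the unit interval only. \<open>Top\<close> sees no other
    values, so one further application yields equality of functions everywhere.\<close>
  have "{x \<in> {0..1}. y \<le> G r x} = {x \<in> {0..1}. y \<le> g x}" for y
    using assms(3) by (auto simp: G_def)
  then have "pinv (G r) = pinv g"
    by (simp add: pinv_def[abs_def])
  moreover have "integral {0..1} (G r) = integral {0..1} g"
    using assms(3) by (intro integral_cong) (simp add: G_def)
  ultimately have "Top (G r) = Top g"
    by (simp add: Top_def[abs_def])
  then have period: "G (Suc i + r) = G (Suc i)" for i
    by (induction i) (simp_all add: G_def)
  have periods: "G (Suc i + k * r) = G (Suc i)" for i k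
  proof (induction k)
    case (Suc k)
    then show ?case
      using period[of "i + k * r"] by (simp add: algebra_simps)
  qed simp
  have cross: "crossing_le (hseq (Suc n)) (G i)" if "2 \<le> i" for n i
  proof -
    obtain j where j: "i = Suc j"
      using \<open>2 \<le> i\<close> by (cases i) auto
    \<comment> \<open>Adding \<open>n\<close> periods raises the index to at least
      \<open>n + 2\<close> without changing \<open>G i\<close>.\<close>
    have "n * 1 \<le> n * r"
      using assms(1) by (intro mult_le_mono2)
    then have "n + 2 \<le> i + n * r"
      using that by linarith
    then show ?thesis
      using crossing_le_hseq[OF assms(2), of n "i + n * r"] periods[of j n] by (simp add: G_def j)
  qed

  define C where "C n = integral {0..1} (hseq (Suc n))" for n
  define c where "c i = integral {0..1} (G i)" for i
  have c_pos: "0 < c i" if "2 \<le> i" for i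
    using integral_in_E_pos[OF profile_in_E[OF profile_G[OF that]]] by (simp add: c_def)
  have c_le_C: "c i \<le> C n" if "2 \<le> i" for i n
    unfolding c_def C_def
    using that by (intro integral_le in_E_integrable profile_in_E profile_G profile_hseq
        crossing_le_imp_ge[OF profile_hseq profile_G cross]) auto
  have "decseq C"
    unfolding C_def
    by (intro decseq_SucI integral_le in_E_integrable profile_in_E profile_hseq hseq_antimono) auto
  then obtain L where L: "C \<longlonglongrightarrow> L" "\<And>n. L \<le> C n"
    using decseq_convergent[of C "c 2"] c_le_C by auto
  have c_le_L: "c i \<le> L" if "2 \<le> i" for i
    using LIMSEQ_le_const[OF L(1)] c_le_C[OF that] by blast
  then have "0 < L"
    using c_pos[of 2] by force
  have C_pos: "0 < C n" for n
    using c_pos[of 2] c_le_C[of 2 n] by simp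
  have ratio_tendsto: "(\<lambda>n. c i / C n) \<longlonglongrightarrow> c i / L" for i
    using \<open>0 < L\<close> by (intro tendsto_intros L) auto
  have "(\<lambda>n. c i / C n * C (Suc n)) \<longlonglongrightarrow> c i / L * L" for i
    by (intro tendsto_mult ratio_tendsto LIMSEQ_Suc L)
  then have product_tendsto: "(\<lambda>n. c i / C n * C (Suc n)) \<longlonglongrightarrow> c i" for i
    using \<open>0 < L\<close> by simp
  have rescaled: "hseq (Suc (Suc n)) x \<le> G (Suc i) (c i / C n * x)" if "2 \<le> i" "0 \<le> x" for n i x
    using Top_le_rescaled_Top[OF profile_hseq profile_G[OF that(1)], of n "c i / C n" x]
      cross[of "Suc i" "Suc n"] that
    by (simp add: hseq_Suc G_Suc c_def C_def)
  have key: "c i / C n * C (Suc n) + integral {c i / C n..1} (G (Suc i)) \<le> c (Suc i)"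
    if "2 \<le> i" for n i
    unfolding c_def[of "Suc i"] C_def[of "Suc n"]
    using that c_pos[OF that] C_pos[of n] c_le_C[OF that, of n]
    by (intro integral_rescaled_le profile_hseq profile_G rescaled) auto
  have G_nonneg: "0 \<le> G i x" if "2 \<le> i" "0 \<le> x" for i x
    using profile_bounds[OF profile_G] that by auto
  \<comment> \<open>Drop the nonnegative remainder in \<open>key\<close> and let \<open>n\<close>
    grow.\<close>
  have c_Suc: "c i \<le> c (Suc i)" if "2 \<le> i" for i
  proof (rule LIMSEQ_le_const2[OF product_tendsto[of i]], intro exI allI impI)
    fix n :: nat
    have "0 \<le> c i / C n"
      using c_pos[OF that] C_pos[of n] by simp
    then have "0 \<le> integral {c i / C n..1} (G (Suc i))"
      using \<open>2 \<le> i\<close> by (intro integral_nonneg in_E_integrable profile_in_E profile_G G_nonneg) auto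
    then show "c i / C n * C (Suc n) \<le> c (Suc i)"
      using key[OF that, of n] by linarith
  qed
  \<comment> \<open>The values \<open>c i\<close> increase and repeat with period \<open>r\<close>,
    so going once round the cycle forces equality.\<close>
  have c_eq: "c (Suc i) = c i" if "2 \<le> i" for i
  proof -
    have "c (Suc i) \<le> c (Suc i + k)" for k
      by (induction k) (use that c_Suc in \<open>auto intro: order_trans\<close>)
    from this[of "r - 1"] have "c (Suc i) \<le> c (i + r)"
      using assms(1) by simp
    moreover have "G (i + r) = G i"
      using period[of "i - 1"] that by simp
    ultimately show ?thesis
      using c_Suc[OF that] by (simp add: c_def)
  qed

  \<comment> \<open>\<open>Suc i = 3 * r\<close> is a multiple of \<open>r\<close>, so
    \<open>G (Suc i)\<close> agrees with \<open>g\<close> on the unit interval; the factor 3 gives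
    \<open>2 \<le> i\<close> even for \<open>r = 1\<close>.\<close>
  define i where "i = 3 * r - 1"
  have i: "2 \<le> i"
    using assms(1) by (simp add: i_def)
  have Gg: "G (Suc i) x = g x" if "x \<in> {0..1}" for x
  proof -
    have "G (Suc i) = G r"
      using periods[of "r - 1" 2] assms(1) by (simp add: i_def algebra_simps)
    then show ?thesis
      using assms(3) that by (simp add: G_def)
  qed
  have profile_i: "profile (G (Suc i))"
    using profile_G i by simp
  define \<rho> where "\<rho> = c i / L"
  have \<rho>: "0 < \<rho>" "\<rho> \<le> 1"
    using c_pos[OF i] c_le_L[OF i] \<open>0 < L\<close> by (auto simp: \<rho>_def)
  \<comment> \<open>Since \<open>L \<le> C n\<close>, the interval from \<open>\<rho>\<close> to 1
    lies inside the one in \<open>key\<close>; as \<open>c (Suc i) = c i\<close>, the limit leaves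
    no room for this remainder.\<close>
  have "integral {\<rho>..1} (G (Suc i)) \<le> 0"
  proof -
    have "c i / C n * C (Suc n) \<le> c i - integral {\<rho>..1} (G (Suc i))" for n
    proof -
      have le: "c i / C n \<le> \<rho>"
        unfolding \<rho>_def using c_pos[OF i] L(2)[of n] \<open>0 < L\<close> by (intro divide_left_mono) auto
      moreover have nonneg: "0 \<le> c i / C n"
        using c_pos[OF i] C_pos[of n] by simp
      ultimately have "integral {\<rho>..1} (G (Suc i)) \<le> integral {c i / C n..1} (G (Suc i))"
        using \<rho> i order_trans[OF nonneg]
        by (intro integral_subset_le in_E_integrable profile_in_E profile_i) (auto intro!: G_nonneg)
      then show ?thesis
        using key[OF i, of n] c_eq[OF i] by linarith
    qed
    then have "c i \<le> c i - integral {\<rho>..1} (G (Suc i))"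
      using LIMSEQ_le_const2[OF product_tendsto[of i]] by blast
    then show ?thesis
      by simp
  qed
  moreover have "0 < integral {\<rho>..1} (G (Suc i))" if "\<rho> < 1"
  proof -
    have cont: "continuous_on {\<rho>..1} (G (Suc i))"
      using profile_i \<rho> by (auto simp: profile_def intro: continuous_on_subset)
    have "integral {\<rho>..1} (G (Suc i)) \<noteq> 0"
      using integral_eq_0_iff[OF cont that] G_nonneg i \<rho> profile_pos[OF profile_i, of \<rho>] that by force
    moreover have "0 \<le> integral {\<rho>..1} (G (Suc i))"
      using cont G_nonneg i \<rho> by (intro integral_nonneg integrable_continuous_interval) auto
    ultimately show ?thesis
      by simp
  qed
  ultimately have "\<rho> = 1"
    using \<rho> by force
  show ?thesis
  proof (intro ballI antisym)
    fix x :: real assume x: "x \<in> {0..1}"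
    have "G (Suc i) x \<le> hseq (Suc n) x" for n
      using x i by (intro crossing_le_imp_ge[OF profile_hseq profile_i cross]) auto
    then show "g x \<le> hlim x"
      using LIMSEQ_le_const[OF hseq_tendsto_hlim[of x]] x Gg[OF x] by auto
    \<comment> \<open>With \<open>\<rho> = 1\<close> the rescaling factor tends to 1, so
      \<open>rescaled\<close> becomes \<open>hlim x \<le> G (Suc i) x\<close> in the limit.\<close>
    have "(\<lambda>n. c i / C n * x) \<longlonglongrightarrow> 1 * x"
      using ratio_tendsto[of i] \<open>\<rho> = 1\<close> by (intro tendsto_mult) (auto simp: \<rho>_def)
    moreover have "c i / C n * x \<in> {0..1}" for n
      using c_pos[OF i] C_pos[of n] c_le_C[OF i, of n] x mult_le_one[of "c i / C n" x] by auto
    moreover have "continuous_on {0..1} (G (Suc i))"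
      using profile_i by (simp add: profile_def)
    ultimately have "(\<lambda>n. G (Suc i) (c i / C n * x)) \<longlonglongrightarrow> G (Suc i) x"
      using x by (intro continuous_on_tendsto_compose[of "{0..1}" "G (Suc i)"]) auto
    then show "hlim x \<le> g x"
      using LIMSEQ_le[OF LIMSEQ_Suc[OF hseq_tendsto_hlim[of x]]] rescaled[OF i] x Gg[OF x] by auto
  qed
qed

end
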